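(* Let $B\ge 3$ be odd. Every Gaussian $B$-happy number is an element of $1+(1+i)\mathbb{Z}[i]$. In particular, if $D\in\mathbb{Z}[i]\setminus\{0\}$ and there is a $D$-consecutive sequence of at least two Gaussian $B$-happy numbers, then $D\in(1+i)\mathbb{Z}[i]$.
   Context: Fix an integer $B\ge 2$. Every nonzero Gaussian integer $a+bi$ is written uniquely as $a+bi=\sum_{j=0}^n (a_j+b_ji)B^j$ with $a_j,b_j\in\mathbb{Z}$, $a_n,b_n$ not both $0$, and for each $j$: $|a_j|\le B-1$, $|b_j|\le B-1$, $\operatorname{sgn}(a)a_j\ge 0$, $\operatorname{sgn}(b)b_j\ge 0$. The Gaussian $B$-happy function $S_B:\mathbb{Z}[i]\to\mathbb{Z}[i]$ is defined by $S_B(0)=0$ and $S_B(a+bi)=\sum_{j=0}^n (a_j+b_ji)^2$. A Gaussian integer $z$ is Gaussian $B$-happy if $S_B^k(z)=1$ for some $k\ge1$. For $D\in\mathbb{Z}[i]\setminus\{0\}$, a $D$-consecutive sequence of length $m$ is a sequence $z,z+D,z+2D,\dots,z+(m-1)D$ with $z\in\mathbb{Z}[i]$. *)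

theory Defs
  imports Complex_Main "HOL-Library.Set_Algebras"
begin

definition gauss_ints :: "complex set" where
  "gauss_ints = {Complex (of_int a) (of_int b) | a b. True}"

text \<open>
  The digits in base \<open>B\<close> of \<open>z\<close> are \<open>a j + b j * \<i>\<close> for \<open>j \<le> n\<close>; the values of
  \<open>a\<close> and \<open>b\<close> beyond \<open>n\<close> are irrelevant. For a part of \<open>z\<close> that is \<open>0\<close> the sign
  condition is vacuous, but then the bound on the digits forces them to vanish.
\<close>

definition gauss_expansion ::
  "int \<Rightarrow> complex \<Rightarrow> nat \<Rightarrow> (nat \<Rightarrow> int) \<Rightarrow> (nat \<Rightarrow> int) \<Rightarrow> bool" where
  "gauss_expansion B z n a b \<longleftrightarrow>
     z = (\<Sum>j\<le>n. Complex (of_int (a j)) (of_int (b j)) * of_int B ^ j) \<and>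
     \<not> (a n = 0 \<and> b n = 0) \<and>
     (\<forall>j\<le>n. \<bar>a j\<bar> \<le> B - 1 \<and> \<bar>b j\<bar> \<le> B - 1 \<and>
            sgn (Re z) * of_int (a j) \<ge> 0 \<and> sgn (Im z) * of_int (b j) \<ge> 0)"

text \<open>The description is meaningful for \<open>z \<in> gauss_ints\<close> and \<open>B \<ge> 2\<close>, see
  \<open>gauss_expansion_exists\<close> and \<open>gauss_expansion_unique\<close> below.\<close>

definition gauss_happy_fun :: "int \<Rightarrow> complex \<Rightarrow> complex" where
  "gauss_happy_fun B z =
     (if z = 0 then 0
      else THE w. \<exists>n a b. gauss_expansion B z n a b \<and>
             w = (\<Sum>j\<le>n. (Complex (of_int (a j)) (of_int (b j)))\<^sup>2))"

definition gauss_happy :: "int \<Rightarrow> complex \<Rightarrow> bool" where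
  "gauss_happy B z \<longleftrightarrow> z \<in> gauss_ints \<and> (\<exists>k\<ge>1. (gauss_happy_fun B ^^ k) z = 1)"

definition consecutive_seq :: "complex \<Rightarrow> nat \<Rightarrow> complex list \<Rightarrow> bool" where
  "consecutive_seq D m zs \<longleftrightarrow>
     (\<exists>z\<in>gauss_ints. zs = map (\<lambda>k. z + of_nat k * D) [0..<m])"

lemma int_digits_zero:
  fixes c :: "nat \<Rightarrow> int" and B :: int
  assumes "B \<ge> 2" "\<And>j. \<bar>c j\<bar> \<le> B - 1" "(\<Sum>j\<le>n. c j * B ^ j) = 0" "j \<le> n"
  shows "c j = 0"
  using assms(2-4)
proof (induction n arbitrary: c j)
  case 0
  then show ?case by simp
next
  case (Suc n)
  have eq: "(\<Sum>j\<le>Suc n. c j * B ^ j) = c 0 + B * (\<Sum>j\<le>n. c (Suc j) * B ^ j)"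
    by (simp only: sum.atMost_Suc_shift) (simp add: sum_distrib_left mult_ac)
  then have "B dvd c 0"
    using Suc.prems(2) by (metis dvd_0_right dvd_add_left_iff dvd_triv_left)
  moreover have "\<bar>c 0\<bar> < B" using Suc.prems(1)[of 0] by linarith
  ultimately have c0: "c 0 = 0"
    using zdvd_not_zless[of "\<bar>c 0\<bar>" B] by force
  then have "(\<Sum>j\<le>n. c (Suc j) * B ^ j) = 0"
    using eq Suc.prems(2) assms(1) by auto
  then have "c (Suc i) = 0" if "i \<le> n" for i
    using Suc.IH[of "\<lambda>j. c (Suc j)" i] Suc.prems(1) that by auto
  then show ?case using c0 Suc.prems(3) by (cases j) auto
qed

lemma int_digits_unique:
  fixes c d :: "nat \<Rightarrow> int" and B x :: int
  assumes B: "B \<ge> 2" and c: "\<And>j. \<bar>c j\<bar> \<le> B - 1" "\<And>j. sgn x * c j \<ge> 0"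
    and d: "\<And>j. \<bar>d j\<bar> \<le> B - 1" "\<And>j. sgn x * d j \<ge> 0"
    and xc: "x = (\<Sum>j\<le>n. c j * B ^ j)" and xd: "x = (\<Sum>j\<le>n. d j * B ^ j)" and "j \<le> n"
  shows "c j = d j"
proof (cases "x = 0")
  case True
  then show ?thesis
    using int_digits_zero[OF B c(1) xc[symmetric, unfolded True] \<open>j \<le> n\<close>]
      int_digits_zero[OF B d(1) xd[symmetric, unfolded True] \<open>j \<le> n\<close>] by simp
next
  case False
  have "\<bar>c j - d j\<bar> \<le> B - 1" for j
    using c(1)[of j] d(1)[of j] c(2)[of j] d(2)[of j] False by (auto simp: sgn_if split: if_splits)
  moreover have "(\<Sum>j\<le>n. (c j - d j) * B ^ j) = 0"
    by (simp add: left_diff_distrib sum_subtractf flip: xc xd)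
  ultimately have "c j - d j = 0"
    using int_digits_zero[OF B, of "\<lambda>j. c j - d j" n j] \<open>j \<le> n\<close> by blast
  then show ?thesis by simp
qed

lemma int_digits_sum:
  fixes m B :: int
  assumes "B \<ge> 2" "m \<ge> 0"
  shows "(\<Sum>j<n. (m div B ^ j mod B) * B ^ j) = m mod B ^ n"
proof (induction n)
  case (Suc n)
  have "m mod (B ^ n * B) = B ^ n * (m div B ^ n mod B) + m mod B ^ n"
    using assms by (intro zmod_zmult2_eq) auto
  then show ?case using Suc by (simp add: mult.commute)
qed simp

lemma Complex_sum_digits:
  "(\<Sum>j\<le>n. Complex (of_int (a j)) (of_int (b j)) * of_int B ^ j) =
   Complex (of_int (\<Sum>j\<le>n. a j * B ^ j)) (of_int (\<Sum>j\<le>n. b j * B ^ j))"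
proof -
  have "of_int B ^ j = (of_real (of_int (B ^ j)) :: complex)" for j by simp
  then show ?thesis by (intro complex_eqI) (simp_all add: Re_sum Im_sum del: of_int_power of_real_of_int_eq)
qed

lemma gauss_expansion_exists:
  assumes B: "B \<ge> 2" and z: "z \<in> gauss_ints" "z \<noteq> 0"
  shows "\<exists>n a b. gauss_expansion B z n a b"
proof -
  obtain x y :: int where xy: "z = Complex (of_int x) (of_int y)"
    using z by (auto simp: gauss_ints_def)
  define P where "P n \<longleftrightarrow> \<bar>x\<bar> < B ^ n \<and> \<bar>y\<bar> < B ^ n" for n
  have lt: "int k < B ^ k" for k
  proof -
    have "int k < 2 ^ k" by (metis less_exp of_nat_less_iff of_nat_numeral of_nat_power)
    also have "\<dots> \<le> B ^ k" using B by (intro power_mono) auto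
    finally show ?thesis .
  qed
  have "P (nat \<bar>x\<bar> + nat \<bar>y\<bar>)"
    unfolding P_def using lt[of "nat \<bar>x\<bar> + nat \<bar>y\<bar>"] by linarith
  moreover have "\<not> P 0" using z xy by (auto simp: P_def complex_eq_iff)
  ultimately obtain n where n: "\<not> P n" "P (Suc n)"
    using nat_induct[of "\<lambda>n. \<not> P n"] by blast
  define dg where "dg t j = sgn t * (\<bar>t\<bar> div B ^ j mod B)" for t :: int and j
  have dg_sum: "(\<Sum>j\<le>n. dg t j * B ^ j) = t" if "\<bar>t\<bar> < B ^ Suc n" for t
  proof -
    have "(\<Sum>j\<le>n. dg t j * B ^ j) = sgn t * (\<Sum>j<Suc n. (\<bar>t\<bar> div B ^ j mod B) * B ^ j)"
      by (simp only: dg_def sum_distrib_left mult.assoc lessThan_Suc_atMost)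
    also have "\<dots> = t" using int_digits_sum[OF B, of "\<bar>t\<bar>" "Suc n"] that
      by (simp add: sgn_mult_abs del: sum.lessThan_Suc)
    finally show ?thesis .
  qed
  have dg_nz: "dg t n \<noteq> 0" if "\<bar>t\<bar> < B ^ Suc n" "\<not> \<bar>t\<bar> < B ^ n" for t
  proof -
    have Bn: "B ^ n > 0" using B by simp
    have "\<bar>t\<bar> div B ^ n > 0" using that Bn by (simp add: pos_imp_zdiv_pos_iff)
    moreover have "\<bar>t\<bar> div B ^ n < B"
    proof (rule ccontr)
      assume "\<not> \<bar>t\<bar> div B ^ n < B"
      then have "B * B ^ n \<le> \<bar>t\<bar> div B ^ n * B ^ n" using Bn by (intro mult_right_mono) auto
      also have "\<dots> \<le> \<bar>t\<bar>"
        using Bn div_mult_mod_eq[of "\<bar>t\<bar>" "B ^ n"] pos_mod_sign[of "B ^ n" "\<bar>t\<bar>"] by linarith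
      finally show False using that by simp
    qed
    moreover have "t \<noteq> 0" using that Bn by auto
    ultimately show ?thesis by (simp add: dg_def sgn_eq_0_iff)
  qed
  have dg_sgn: "sgn t * dg t j \<ge> 0" "\<bar>dg t j\<bar> \<le> B - 1" for t j
    using B pos_mod_bound[of B "\<bar>t\<bar> div B ^ j"] pos_mod_sign[of B "\<bar>t\<bar> div B ^ j"]
    by (auto simp: dg_def sgn_if)
  have "sgn (real_of_int t) * of_int (dg t j) \<ge> 0" for t j
    using dg_sgn(1)[of t j] by (auto simp: sgn_if split: if_splits)
  then have "gauss_expansion B z n (dg x) (dg y)"
    unfolding gauss_expansion_def Complex_sum_digits
    using n dg_sum dg_nz dg_sgn(2) by (auto simp: P_def xy)
  then show ?thesis by blast
qed

lemma gauss_expansion_pad: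
  assumes "gauss_expansion B z n a b" "n \<le> N" "B \<ge> 2"
    and "z = Complex (of_int x) (of_int y)"
  defines "a' \<equiv> (\<lambda>j. if j \<le> n then a j else 0)" and "b' \<equiv> (\<lambda>j. if j \<le> n then b j else 0)"
  shows "x = (\<Sum>j\<le>N. a' j * B ^ j)" "y = (\<Sum>j\<le>N. b' j * B ^ j)"
    "\<bar>a' j\<bar> \<le> B - 1" "\<bar>b' j\<bar> \<le> B - 1" "sgn x * a' j \<ge> 0" "sgn y * b' j \<ge> 0"
proof -
  have "(\<Sum>j\<le>n. a j * B ^ j) = (\<Sum>j\<le>N. a' j * B ^ j)"
    "(\<Sum>j\<le>n. b j * B ^ j) = (\<Sum>j\<le>N. b' j * B ^ j)"
    using assms(2) by (auto intro!: sum.mono_neutral_cong_left simp: a'_def b'_def split: if_splits)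
  then show "x = (\<Sum>j\<le>N. a' j * B ^ j)" "y = (\<Sum>j\<le>N. b' j * B ^ j)"
    using assms(1,4) unfolding gauss_expansion_def Complex_sum_digits
    by (simp_all only: complex.inject of_int_eq_iff)
  show "\<bar>a' j\<bar> \<le> B - 1" "\<bar>b' j\<bar> \<le> B - 1"
    using assms(1,3) by (auto simp: gauss_expansion_def a'_def b'_def)
  have "sgn (real_of_int x) * of_int (a' j) \<ge> 0" "sgn (real_of_int y) * of_int (b' j) \<ge> 0"
    using assms(1,4) by (auto simp: gauss_expansion_def a'_def b'_def)
  then show "sgn x * a' j \<ge> 0" "sgn y * b' j \<ge> 0"
    by (auto simp: sgn_if split: if_splits)
qed

lemma gauss_expansion_unique:
  assumes B: "B \<ge> 2" and z: "z \<in> gauss_ints"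
    and e: "gauss_expansion B z n a b" and e': "gauss_expansion B z n' a' b'"
  shows "n = n'" "\<And>j. j \<le> n \<Longrightarrow> a j = a' j \<and> b j = b' j"
proof -
  obtain x y :: int where xy: "z = Complex (of_int x) (of_int y)"
    using z by (auto simp: gauss_ints_def)
  define N where "N = max n n'"
  have N: "n \<le> N" "n' \<le> N" by (auto simp: N_def)
  note p = gauss_expansion_pad[OF e N(1) B xy] and p' = gauss_expansion_pad[OF e' N(2) B xy]
  have eq: "(if j \<le> n then a j else 0) = (if j \<le> n' then a' j else 0)"
    "(if j \<le> n then b j else 0) = (if j \<le> n' then b' j else 0)" if "j \<le> N" for j
    using int_digits_unique[OF B p(3) p(5) p'(3) p'(5) p(1) p'(1) that]
      int_digits_unique[OF B p(4) p(6) p'(4) p'(6) p(2) p'(2) that] by simp_all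
  have "\<not> n < n'" "\<not> n' < n"
    using e e' eq[of n] eq[of n'] N by (auto simp: gauss_expansion_def)
  then show "n = n'" by simp
  then show "a j = a' j \<and> b j = b' j" if "j \<le> n" for j
    using eq[of j] that N by auto
qed

lemma gauss_happy_fun_expansion:
  assumes "B \<ge> 2" "z \<in> gauss_ints" "z \<noteq> 0" "gauss_expansion B z n a b"
  shows "gauss_happy_fun B z = (\<Sum>j\<le>n. (Complex (of_int (a j)) (of_int (b j)))\<^sup>2)"
proof -
  have "(\<Sum>j\<le>n'. (Complex (of_int (a' j)) (of_int (b' j)))\<^sup>2) =
      (\<Sum>j\<le>n. (Complex (of_int (a j)) (of_int (b j)))\<^sup>2)"
    if "gauss_expansion B z n' a' b'" for n' a' b'
  proof -
    note u = gauss_expansion_unique[OF assms(1,2,4) that]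
    show ?thesis unfolding u(1)[symmetric] by (rule sum.cong) (simp_all add: u(2))
  qed
  then have "(THE w. \<exists>n a b. gauss_expansion B z n a b \<and>
        w = (\<Sum>j\<le>n. (Complex (of_int (a j)) (of_int (b j)))\<^sup>2)) =
      (\<Sum>j\<le>n. (Complex (of_int (a j)) (of_int (b j)))\<^sup>2)"
    using assms(4) by (intro the_equality) blast+
  then show ?thesis
    by (simp only: gauss_happy_fun_def assms(3) if_False)
qed

end

theory Submission
  imports Defs
begin

text \<open>
  The ideal \<open>(1 + \<i>)\<int>[\<i>]\<close> consists of the \<open>x + y\<i>\<close> with \<open>x + y\<close> even. Modulo this ideal
  squaring is the identity and the odd base is \<open>1\<close>, so the happy function preserves
  the residue class. Hence every number whose orbit reaches \<open>1\<close> is in the class of \<open>1\<close>.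
\<close>

text \<open>Multiplying out, \<open>(1 + \<i>) * (a + b * \<i>)\<close> has parts
  \<open>a - b\<close> and \<open>a + b\<close>, which add up to the even number
  \<open>2 * a\<close>. Conversely, these two equations can be solved for integers \<open>a\<close>
  and \<open>b\<close> as soon as \<open>x + y\<close> is even.\<close>

lemma Complex_mem_one_plus_i_ideal_iff:
  "Complex (of_int x) (of_int y) \<in> (1 + \<i>) *o gauss_ints \<longleftrightarrow> even (x + y)"
proof
  assume "Complex (of_int x) (of_int y) \<in> (1 + \<i>) *o gauss_ints"
  then obtain a b :: int
    where "Complex (of_int x) (of_int y) = (1 + \<i>) * Complex (of_int a) (of_int b)"
    by (auto simp: elt_set_times_def gauss_ints_def)
  then have "real_of_int x = of_int (a - b)" "real_of_int y = of_int (a + b)"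
    by (simp_all add: complex_eq_iff)
  then have "x = a - b" "y = a + b"
    by (simp_all only: of_int_eq_iff)
  then show "even (x + y)"
    by simp
next
  assume "even (x + y)"
  then obtain k where "y = 2 * k - x"
    by (metis add_diff_cancel_left' dvdE)
  \<comment> \<open>The cofactor is the solution of \<open>a - b = x\<close> and
    \<open>a + b = y = 2 * k - x\<close>.\<close>
  then have "Complex (of_int x) (of_int y) = (1 + \<i>) * Complex (of_int k) (of_int (k - x))"
    by (simp add: complex_eq_iff)
  then show "Complex (of_int x) (of_int y) \<in> (1 + \<i>) *o gauss_ints"
    unfolding elt_set_times_def gauss_ints_def by blast
qed

lemma even_sum_cong:
  fixes f g :: "'a \<Rightarrow> int"
  assumes "\<And>j. j \<in> A \<Longrightarrow> even (f j) \<longleftrightarrow> even (g j)"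
  shows "even (sum f A) \<longleftrightarrow> even (sum g A)"
proof -
  have "even (\<Sum>j\<in>A. f j - g j)"
    using assms by (intro dvd_sum) auto
  then show ?thesis
    by (simp add: sum_subtractf)
qed

text \<open>The integer witnesses \<open>u\<close> and \<open>v\<close> also record that the value
  is again a Gaussian integer, which lets the statement be iterated.\<close>

lemma gauss_happy_fun_parity:
  assumes "B \<ge> 2" "odd B"
  shows "\<exists>u v. gauss_happy_fun B (Complex (of_int x) (of_int y)) = Complex (of_int u) (of_int v) \<and>
    (even (u + v) \<longleftrightarrow> even (x + y))"
proof (cases "Complex (of_int x) (of_int y) = 0")
  \<comment> \<open>Zero has no expansion, as its leading digit would have to be nonzero; here the
    value is fixed by definition.\<close>
  case True
  then have "x = 0" "y = 0"
    by (simp_all add: complex_eq_iff)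
  then show ?thesis
    by (intro exI[of _ 0]) (simp add: gauss_happy_fun_def complex_eq_iff)
next
  case False
  let ?z = "Complex (of_int x) (of_int y)"
  have z: "?z \<in> gauss_ints"
    by (auto simp: gauss_ints_def)
  obtain n a b where e: "gauss_expansion B ?z n a b"
    using gauss_expansion_exists[OF assms(1) z False] by blast
  define u where "u = (\<Sum>j\<le>n. (a j)\<^sup>2 - (b j)\<^sup>2)"
  define v where "v = (\<Sum>j\<le>n. 2 * a j * b j)"
  have "gauss_happy_fun B ?z = Complex (of_int u) (of_int v)"
    unfolding gauss_happy_fun_expansion[OF assms(1) z False e]
    by (simp add: u_def v_def complex_eq_iff Re_sum Im_sum power2_eq_square mult_ac)
  moreover have "x + y = (\<Sum>j\<le>n. (a j + b j) * B ^ j)"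
    using e unfolding gauss_expansion_def Complex_sum_digits
    by (simp only: complex.inject of_int_eq_iff distrib_right sum.distrib)
  moreover have "u + v = (\<Sum>j\<le>n. (a j)\<^sup>2 - (b j)\<^sup>2 + 2 * a j * b j)"
    by (simp add: u_def v_def sum.distrib)
  \<comment> \<open>The comparison is termwise modulo 2: \<open>B ^ j\<close> is odd, squares keep
    parity, a difference has the parity of the sum, and the mixed term \<open>2 * a j * b j\<close>
    drops out.\<close>
  moreover have "even (\<Sum>j\<le>n. (a j)\<^sup>2 - (b j)\<^sup>2 + 2 * a j * b j) \<longleftrightarrow>
      even (\<Sum>j\<le>n. (a j + b j) * B ^ j)"
    using assms(2) by (intro even_sum_cong) auto
  ultimately show ?thesis
    by metis
qed

lemma gauss_happy_fun_funpow_parity: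
  assumes "B \<ge> 2" "odd B"
  shows "\<exists>u v. (gauss_happy_fun B ^^ k) (Complex (of_int x) (of_int y)) =
    Complex (of_int u) (of_int v) \<and> (even (u + v) \<longleftrightarrow> even (x + y))"
proof (induction k)
  case 0
  show ?case by auto
next
  case (Suc k)
  then show ?case
    using gauss_happy_fun_parity[OF assms] by (metis comp_apply funpow.simps(2))
qed

lemma gauss_happy_odd:
  assumes "B \<ge> 2" "odd B" "gauss_happy B z"
  obtains x y :: int where "z = Complex (of_int x) (of_int y)" "odd (x + y)"
proof -
  obtain x y k where z: "z = Complex (of_int x) (of_int y)" and k: "(gauss_happy_fun B ^^ k) z = 1"
    using assms(3) by (auto simp: gauss_happy_def gauss_ints_def)
  \<comment> \<open>The orbit ends in 1, whose parts 1 and 0 have an odd sum; parity carries this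
    back to \<open>z\<close>.\<close>
  obtain u v where "Complex (of_int u) (of_int v) = 1" and p: "even (u + v) \<longleftrightarrow> even (x + y)"
    using gauss_happy_fun_funpow_parity[OF assms(1,2), of k x y] k z by auto
  then have "u = 1" "v = 0"
    by (simp_all add: complex_eq_iff)
  then show ?thesis
    using that z p by simp
qed

theorem theorem12:
  fixes B :: int
  assumes "B \<ge> 3" and "odd B"
  shows "(\<forall>z. gauss_happy B z \<longrightarrow> z \<in> 1 +o ((1 + \<i>) *o gauss_ints)) \<and>
    (\<forall>D \<in> gauss_ints - {0}.
       (\<exists>m\<ge>2. \<exists>zs. consecutive_seq D m zs \<and> (\<forall>z\<in>set zs. gauss_happy B z)) \<longrightarrow>
       D \<in> (1 + \<i>) *o gauss_ints)"
proof (intro conjI allI ballI impI)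
  have B: "B \<ge> 2"
    using assms(1) by simp
  show "z \<in> 1 +o ((1 + \<i>) *o gauss_ints)" if happy: "gauss_happy B z" for z
  proof -
    obtain x y where z: "z = Complex (of_int x) (of_int y)" and "odd (x + y)"
      using gauss_happy_odd[OF B assms(2) happy] by blast
    then have "Complex (of_int (x - 1)) (of_int y) \<in> (1 + \<i>) *o gauss_ints"
      unfolding Complex_mem_one_plus_i_ideal_iff by simp
    moreover have "z = 1 + Complex (of_int (x - 1)) (of_int y)"
      by (simp add: z complex_eq_iff)
    ultimately show ?thesis
      by (auto simp: elt_set_plus_def)
  qed
  show "D \<in> (1 + \<i>) *o gauss_ints"
    if seq: "\<exists>m\<ge>2. \<exists>zs. consecutive_seq D m zs \<and> (\<forall>z\<in>set zs. gauss_happy B z)" for D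
  proof -
    obtain m z where "m \<ge> 2" and h: "\<forall>k\<in>{0..<m}. gauss_happy B (z + of_nat k * D)"
      using seq by (auto simp: consecutive_seq_def)
    \<comment> \<open>Since \<open>m\<close> is at least 2, the indices 0 and 1 both occur, and
      \<open>D\<close> is the difference of these two terms. Both lie in the odd class, so the parts
      of \<open>D\<close> have an even sum.\<close>
    then have "gauss_happy B z" "gauss_happy B (z + D)"
      using bspec[OF h, of 0] bspec[OF h, of 1] by simp_all
    then obtain x y x' y' where z: "z = Complex (of_int x) (of_int y)" "odd (x + y)"
      and z': "z + D = Complex (of_int x') (of_int y')" "odd (x' + y')"
      using gauss_happy_odd[OF B assms(2)] by metis
    have "D = Complex (of_int (x' - x)) (of_int (y' - y))"
      using z(1) z'(1) by (auto simp: complex_eq_iff)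
    moreover have "even ((x' - x) + (y' - y))"
      using z(2) z'(2) by presburger
    ultimately show ?thesis
      using Complex_mem_one_plus_i_ideal_iff by metis
  qed
qed

end
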